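(* Let $n \geq 1$ and let $\mathcal{S}$ be a non-empty collection of non-empty subsets of $[n]$. Then the positive semidefinite cone $\mathbb{S}^n_+$ is the conic hull of the (infinite) union of lower dimensional cones $$\mathbb{S}^n_+ = \mathrm{cone}\Big( \bigcup_{S \in \mathcal{S}} \ \bigcup_{F \in O(n)} F_S[\mathbb{S}^{|S|}_+]F_S^T \Big),$$ where, for $S \in \mathcal{S}$ and $F \in O(n)$, $$F_S[\mathbb{S}^{|S|}_+]F_S^T := \{ X \in \mathbb{S}^n_+ : X = F_S Y F_S^T \text{ for some } Y \in \mathbb{S}^{|S|}_+ \},$$ and each set $F_S[\mathbb{S}^{|S|}_+]F_S^T$ is itself a sub-cone (of $\mathbb{S}^n_+$).
   Context: $[n] = \{1,\dots,n\}$ and $|S|$ is the cardinality of $S$. $\mathbb{S}^n$ is the set of real symmetric $n\times n$ matrices, and $\mathbb{S}^n_+$ is the set of $A \in \mathbb{S}^n$ with $x^T A x \geq 0$ for all $x \in \mathbb{R}^n$ (and similarly $\mathbb{S}^m_+$ for other sizes $m$). $O(n)$ is the set of real $n\times n$ orthogonal matrices. For $F \in \mathbb{R}^{n\times n}$ and a non-empty index set $S \subseteq [n]$, $F_S \in \mathbb{R}^{n\times |S|}$ is the submatrix of $F$ consisting of the columns of $F$ indexed by $S$. For a set $C$ in a real vector space, $\mathrm{cone}(C) := \{\sum_{i=1}^k \alpha_i x_i : x_i \in C,\ \alpha_i \in \mathbb{R}_{\geq 0},\ k \in \mathbb{N}\}$. *)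

theory Defs
  imports Complex_Main "Jordan_Normal_Form.DL_Submatrix"
begin

text \<open>Rows and columns are indexed from 0, so the index set \<open>[n]\<close> is \<open>{..<n}\<close>.\<close>

definition psd_cone :: "nat \<Rightarrow> real mat set" where
  "psd_cone n = {A \<in> carrier_mat n n.
     A\<^sup>T = A \<and> (\<forall>x \<in> carrier_vec n. 0 \<le> x \<bullet> (A *\<^sub>v x))}"

definition orthogonal_group :: "nat \<Rightarrow> real mat set" where
  "orthogonal_group n = {F \<in> carrier_mat n n. F\<^sup>T * F = 1\<^sub>m n}"

text \<open>For \<open>S \<subseteq> {..<n}\<close> this is an \<open>n \<times> card S\<close> matrix; the columns keep their
  relative order.\<close>

definition column_submatrix :: "real mat \<Rightarrow> nat set \<Rightarrow> real mat" where
  "column_submatrix F S = submatrix F UNIV S"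

definition mat_cone :: "nat \<Rightarrow> real mat set \<Rightarrow> real mat set" where
  "mat_cone n C =
     {finsum (module_mat TYPE(real) n n) (\<lambda>i. \<alpha> i \<cdot>\<^sub>m X i) {..<k} | (k::nat) \<alpha> X.
        \<forall>i<k. 0 \<le> \<alpha> i \<and> X i \<in> C}"

text \<open>A (convex) cone is a set that equals its own conic hull; since \<open>k = 0\<close> is allowed in
  \<^const>\<open>mat_cone\<close>, such a set contains the zero matrix and in particular is non-empty.\<close>

definition is_subcone :: "nat \<Rightarrow> real mat set \<Rightarrow> real mat set \<Rightarrow> bool" where
  "is_subcone n C K \<longleftrightarrow> C \<subseteq> K \<and> mat_cone n C = C"

definition compressed_psd_cone :: "nat \<Rightarrow> real mat \<Rightarrow> nat set \<Rightarrow> real mat set" where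
  "compressed_psd_cone n F S =
     {X \<in> psd_cone n. \<exists>Y \<in> psd_cone (card S).
        X = column_submatrix F S * Y * (column_submatrix F S)\<^sup>T}"

end

theory Submission
  imports Defs
begin

text \<open>Symmetric Gaussian elimination peels rank one matrices \<open>v v\<^sup>T\<close> off a positive semidefinite
  matrix, clearing one further row at each step. Given \<open>s \<in> S\<close>, a Householder reflection is an
  orthogonal matrix whose column \<open>s\<close> is \<open>v / |v|\<close>; compressing along \<open>S\<close> the matrix whose only
  nonzero entry is \<open>|v|\<^sup>2\<close>, at the diagonal position of \<open>s\<close>, then gives \<open>v v\<^sup>T\<close>.\<close>

section \<open>Conic hulls\<close>

lemma finsum_mat_lessThan_Suc:
  assumes "\<And>i. i \<le> k \<Longrightarrow> f i \<in> carrier_mat n n"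
  shows "finsum (module_mat TYPE(real) n n) f {..<Suc k}
    = finsum (module_mat TYPE(real) n n) f {..<k} + f k"
proof -
  interpret abelian_group "module_mat TYPE(real) n n" by (rule abelian_group_mat)
  have f: "f \<in> {..<k} \<rightarrow> carrier (module_mat TYPE(real) n n)"
    using assms by (auto simp: module_mat_simps)
  then have c: "finsum (module_mat TYPE(real) n n) f {..<k} \<in> carrier_mat n n"
    using finsum_closed[OF f] by (simp add: module_mat_simps)
  have fk: "f k \<in> carrier_mat n n" using assms by simp
  show "finsum (module_mat TYPE(real) n n) f {..<Suc k}
    = finsum (module_mat TYPE(real) n n) f {..<k} + f k"
    \<comment> \<open>\<open>finsum_insert\<close> puts the new summand in front; commutativity
      moves it to the end.\<close>
    unfolding lessThan_Suc using f fk c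
    by (subst finsum_insert) (auto simp: module_mat_simps intro: comm_add_mat)
qed

lemma finsum_mat_empty: "finsum (module_mat TYPE(real) n n) f {} = 0\<^sub>m n n"
proof -
  interpret abelian_group "module_mat TYPE(real) n n" by (rule abelian_group_mat)
  show ?thesis by (simp add: module_mat_simps)
qed

lemma zero_in_mat_cone: "0\<^sub>m n n \<in> mat_cone n C"
  unfolding mat_cone_def
  by (rule CollectI, rule exI[of _ 0]) (simp add: finsum_mat_empty)

text \<open>A conic combination of length k is extended by one term. This builds elements of a conic
  hull one generator at a time, without handling the families of coefficients and generators
  again.\<close>

lemma mat_cone_add_smult:
  assumes C: "C \<subseteq> carrier_mat n n" and M: "M \<in> mat_cone n C" and "0 \<le> c" "X \<in> C"
  shows "M + c \<cdot>\<^sub>m X \<in> mat_cone n C"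
proof -
  interpret abelian_group "module_mat TYPE(real) n n" by (rule abelian_group_mat)
  obtain k :: nat and \<alpha> Y where Y: "\<forall>i<k. 0 \<le> \<alpha> i \<and> Y i \<in> C"
    and Meq: "M = finsum (module_mat TYPE(real) n n) (\<lambda>i. \<alpha> i \<cdot>\<^sub>m Y i) {..<k}"
    using M unfolding mat_cone_def by auto
  \<comment> \<open>The updates take effect at index k only, so the sum over \<open>{..<k}\<close>
    is still \<open>M\<close>.\<close>
  let ?a = "\<alpha>(k := c)" and ?Y = "Y(k := X)"
  have "finsum (module_mat TYPE(real) n n) (\<lambda>i. ?a i \<cdot>\<^sub>m ?Y i) {..<Suc k}
    = finsum (module_mat TYPE(real) n n) (\<lambda>i. ?a i \<cdot>\<^sub>m ?Y i) {..<k} + c \<cdot>\<^sub>m X"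
    using Y C \<open>X \<in> C\<close> by (subst finsum_mat_lessThan_Suc) (auto simp: le_less)
  also have "finsum (module_mat TYPE(real) n n) (\<lambda>i. ?a i \<cdot>\<^sub>m ?Y i) {..<k} = M"
    unfolding Meq using Y C by (intro finsum_cong') (auto simp: module_mat_simps)
  finally show ?thesis
    unfolding mat_cone_def using Y assms
    by (intro CollectI exI[of _ "Suc k"] exI[of _ ?a] exI[of _ ?Y]) (auto simp: less_Suc_eq)
qed

text \<open>Induction on the length of the combination. It gives one inclusion of the conic hull
  identity as well as the closure of each compressed cone under conic combinations.\<close>

lemma mat_cone_subsetI:
  assumes C: "C \<subseteq> carrier_mat n n" and z: "0\<^sub>m n n \<in> K"
    and step: "\<And>A X c. A \<in> K \<Longrightarrow> X \<in> C \<Longrightarrow> 0 \<le> c \<Longrightarrow> A + c \<cdot>\<^sub>m X \<in> K"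
  shows "mat_cone n C \<subseteq> K"
proof -
  have "finsum (module_mat TYPE(real) n n) (\<lambda>i. \<alpha> i \<cdot>\<^sub>m X i) {..<k} \<in> K"
    if "\<forall>i<k. 0 \<le> \<alpha> i \<and> X i \<in> C" for k :: nat and \<alpha> X
    using that
  proof (induction k)
    case 0
    then show ?case using z by (simp add: finsum_mat_empty)
  next
    case (Suc k)
    then show ?case
      using C by (subst finsum_mat_lessThan_Suc) (auto intro!: step smult_carrier_mat)
  qed
  then show ?thesis unfolding mat_cone_def by auto
qed

lemma subset_mat_cone:
  assumes "C \<subseteq> carrier_mat n n"
  shows "C \<subseteq> mat_cone n C"
proof
  fix X assume X: "X \<in> C"
  then have "0\<^sub>m n n + 1 \<cdot>\<^sub>m X \<in> mat_cone n C"
    using assms by (intro mat_cone_add_smult zero_in_mat_cone) auto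
  moreover have "0\<^sub>m n n + 1 \<cdot>\<^sub>m X = X"
    using X assms by (intro eq_matI) auto
  ultimately show "X \<in> mat_cone n C" by simp
qed

section \<open>Positive semidefinite matrices\<close>

lemma psd_cone_carrier: "psd_cone n \<subseteq> carrier_mat n n"
  by (auto simp: psd_cone_def)

lemma zero_in_psd_cone: "0\<^sub>m n n \<in> psd_cone n"
proof -
  have "0\<^sub>m n n *\<^sub>v x = 0\<^sub>v n" if "x \<in> carrier_vec n" for x :: "real vec"
    using that by (intro eq_vecI) auto
  then show ?thesis
    by (simp add: psd_cone_def)
qed

lemma psd_cone_add_smult:
  assumes A: "A \<in> psd_cone n" and X: "X \<in> psd_cone n" and c: "0 \<le> c"
  shows "A + c \<cdot>\<^sub>m X \<in> psd_cone n"
proof -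
  have Ac: "A \<in> carrier_mat n n" and Xc: "X \<in> carrier_mat n n"
    using A X psd_cone_carrier by auto
  have "(A + c \<cdot>\<^sub>m X)\<^sup>T = A\<^sup>T + c \<cdot>\<^sub>m X\<^sup>T"
    using Ac Xc by (intro eq_matI) auto
  moreover have "x \<bullet> ((A + c \<cdot>\<^sub>m X) *\<^sub>v x) = x \<bullet> (A *\<^sub>v x) + c * (x \<bullet> (X *\<^sub>v x))"
    if x: "x \<in> carrier_vec n" for x
  proof -
    have "(c \<cdot>\<^sub>m X) *\<^sub>v x = c \<cdot>\<^sub>v (X *\<^sub>v x)"
      using Xc x by (intro eq_vecI) auto
    then have "(A + c \<cdot>\<^sub>m X) *\<^sub>v x = A *\<^sub>v x + c \<cdot>\<^sub>v (X *\<^sub>v x)"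
      using Ac Xc x by (subst add_mult_distrib_mat_vec) auto
    then show ?thesis
      using Ac Xc x by (simp add: scalar_prod_add_distrib[of _ n])
  qed
  ultimately show ?thesis
    using A X c by (auto simp: psd_cone_def)
qed

text \<open>Moving \<open>M\<close> across the scalar product turns the quadratic form of
  \<open>M * Y * M\<^sup>T\<close> at x into that of \<open>Y\<close> at
  \<open>M\<^sup>T *\<^sub>v x\<close>.\<close>

lemma psd_cone_congruence:
  assumes Y: "Y \<in> psd_cone m" and M: "M \<in> carrier_mat n m"
  shows "M * Y * M\<^sup>T \<in> psd_cone n"
proof -
  have Yc: "Y \<in> carrier_mat m m" and Yt: "Y\<^sup>T = Y"
    and Yp: "\<And>x. x \<in> carrier_vec m \<Longrightarrow> 0 \<le> x \<bullet> (Y *\<^sub>v x)"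
    using Y by (auto simp: psd_cone_def)
  have "(M * Y * M\<^sup>T)\<^sup>T = M * (M * Y)\<^sup>T"
    using M Yc by (subst transpose_mult[of _ n m _ n]) auto
  also have "\<dots> = M * Y * M\<^sup>T"
    using M Yc Yt by (simp add: transpose_mult[of _ n m _ m] assoc_mult_mat[of _ n m _ m _ n])
  finally have "(M * Y * M\<^sup>T)\<^sup>T = M * Y * M\<^sup>T" .
  moreover have "0 \<le> x \<bullet> ((M * Y * M\<^sup>T) *\<^sub>v x)" if x: "x \<in> carrier_vec n" for x
  proof -
    let ?y = "M\<^sup>T *\<^sub>v x"
    have y: "?y \<in> carrier_vec m" using M x by auto
    have "(M * Y * M\<^sup>T) *\<^sub>v x = M *\<^sub>v (Y *\<^sub>v ?y)"
      using M Yc x y assoc_mult_mat_vec[of "M * Y" n m "M\<^sup>T" n x]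
        assoc_mult_mat_vec[of M n m Y m ?y] by simp
    moreover have "x \<bullet> (M *\<^sub>v (Y *\<^sub>v ?y)) = ?y \<bullet> (Y *\<^sub>v ?y)"
      using transpose_vec_mult_scalar[OF M, of "Y *\<^sub>v ?y" x] Yc y x by simp
    ultimately show ?thesis using Yp[OF y] by simp
  qed
  ultimately show ?thesis
    using M Yc by (auto simp: psd_cone_def)
qed

text \<open>The matrix v v^T. The vector is a plain function, of which only the values below n
  matter; this keeps entrywise computations free of dimension conditions.\<close>

definition rank_one :: "nat \<Rightarrow> (nat \<Rightarrow> real) \<Rightarrow> real mat" where
  "rank_one n v = mat n n (\<lambda>(i, j). v i * v j)"

lemma rank_one_eq_mult_transpose:
  "rank_one n v = mat n 1 (\<lambda>(i, j). v i) * (mat n 1 (\<lambda>(i, j). v i))\<^sup>T"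
  by (intro eq_matI) (auto simp: rank_one_def scalar_prod_def)

lemma rank_one_psd: "rank_one n v \<in> psd_cone n"
proof -
  have "(1\<^sub>m 1 :: real mat) \<in> psd_cone 1"
    by (auto simp: psd_cone_def scalar_prod_def)
  from psd_cone_congruence[OF this, of "mat n 1 (\<lambda>(i, j). v i)" n] show ?thesis
    by (simp add: rank_one_eq_mult_transpose)
qed

section \<open>Entries of a positive semidefinite matrix\<close>

lemma psd_cone_sym:
  assumes "A \<in> psd_cone n" "i < n" "j < n"
  shows "A $$ (i, j) = A $$ (j, i)"
proof -
  have "A\<^sup>T $$ (i, j) = A $$ (j, i)"
    using assms psd_cone_carrier[of n] by (intro index_transpose_mat) auto
  then show ?thesis
    using assms(1) by (simp add: psd_cone_def)
qed

text \<open>This is the quadratic form evaluated at t e_k + e_i, with the two mixed terms merged by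
  symmetry.\<close>

lemma psd_cone_quadratic:
  assumes A: "A \<in> psd_cone n" and i: "i < n" and k: "k < n"
  shows "0 \<le> t\<^sup>2 * A $$ (k, k) + 2 * t * A $$ (i, k) + A $$ (i, i)"
proof -
  have Ac: "A \<in> carrier_mat n n" using A by (simp add: psd_cone_def)
  let ?x = "t \<cdot>\<^sub>v unit_vec n k + unit_vec n i"
  have entry: "unit_vec n a \<bullet> (A *\<^sub>v unit_vec n b) = A $$ (a, b)" if "a < n" "b < n" for a b
    using Ac that by (simp add: scalar_prod_left_unit[of _ n] scalar_prod_right_unit)
  have "A *\<^sub>v ?x = t \<cdot>\<^sub>v (A *\<^sub>v unit_vec n k) + A *\<^sub>v unit_vec n i"
    using Ac by (simp add: mult_add_distrib_mat_vec[of _ n n] mult_mat_vec[of _ n n])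
  then have "?x \<bullet> (A *\<^sub>v ?x) = t * (t * A $$ (k, k) + A $$ (k, i)) + (t * A $$ (i, k) + A $$ (i, i))"
    using Ac i k psd_cone_sym[OF A i k]
    by (simp add: add_scalar_prod_distrib[of _ n] scalar_prod_add_distrib[of _ n] entry)
  moreover have "0 \<le> ?x \<bullet> (A *\<^sub>v ?x)"
    using A by (auto simp: psd_cone_def)
  ultimately show ?thesis
    using psd_cone_sym[OF A i k] by (simp add: algebra_simps power2_eq_square)
qed

lemma psd_cone_diag_nonneg:
  assumes "A \<in> psd_cone n" "i < n"
  shows "0 \<le> A $$ (i, i)"
  using psd_cone_quadratic[OF assms(1,2,2), of 0] by simp

text \<open>With a zero diagonal entry the quadratic polynomial in t is affine, and an affine
  function that is nonnegative on the whole line has slope zero.\<close>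

lemma psd_cone_diag_zero:
  assumes A: "A \<in> psd_cone n" and i: "i < n" and k: "k < n" and z: "A $$ (k, k) = 0"
  shows "A $$ (i, k) = 0"
proof (rule ccontr)
  assume nz: "A $$ (i, k) \<noteq> 0"
  \<comment> \<open>Chosen so that the affine function takes the value -1.\<close>
  let ?t = "- (A $$ (i, i) + 1) / (2 * A $$ (i, k))"
  have "2 * ?t * A $$ (i, k) = - (A $$ (i, i) + 1)"
    using nz by (simp add: field_simps)
  then show False
    using psd_cone_quadratic[OF A i k, of ?t] z by simp
qed

text \<open>One step of symmetric elimination with pivot \<open>A $$ (k, k)\<close>. The result is M
  A M^T for an elimination matrix M, so it is positive semidefinite by congruence.\<close>

lemma psd_cone_eliminate:
  assumes A: "A \<in> psd_cone n" and k: "k < n" and pos: "0 < A $$ (k, k)"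
  shows "mat n n (\<lambda>(i, j). A $$ (i, j) - A $$ (i, k) * A $$ (j, k) / A $$ (k, k)) \<in> psd_cone n"
proof -
  have Ac: "A \<in> carrier_mat n n" using A by (simp add: psd_cone_def)
  let ?a = "A $$ (k, k)"
  let ?B = "mat n n (\<lambda>(i, j). A $$ (i, j) - A $$ (i, k) * A $$ (j, k) / ?a)"
  \<comment> \<open>From each row i, \<open>M\<close> subtracts A_ik / A_kk times row k. This
    includes i = k, so the pivot row itself becomes zero.\<close>
  define M where "M = mat n n (\<lambda>(i, j). (if i = j then 1 else 0) - (if j = k then A $$ (i, k) / ?a else 0))"
  have M: "M \<in> carrier_mat n n" by (simp add: M_def)
  have MA: "M * A = ?B"
  proof (intro eq_matI)
    fix i j assume "i < dim_row ?B" "j < dim_col ?B"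
    then have ij: "i < n" "j < n" by auto
    have "(M * A) $$ (i, j) = (\<Sum>l<n. M $$ (i, l) * A $$ (l, j))"
      using Ac M ij by (simp add: scalar_prod_def atLeast0LessThan)
    also have "\<dots> = (\<Sum>l<n. (if i = l then A $$ (l, j) else 0)
        - (if l = k then A $$ (i, k) / ?a * A $$ (l, j) else 0))"
      using ij by (intro sum.cong) (auto simp: M_def algebra_simps)
    also have "\<dots> = A $$ (i, j) - A $$ (i, k) / ?a * A $$ (k, j)"
      using ij k by (simp add: sum_subtractf)
    finally show "(M * A) $$ (i, j) = ?B $$ (i, j)"
      using ij psd_cone_sym[OF A k ij(2)] by simp
  qed (use Ac M in auto)
  \<comment> \<open>The right factor subtracts multiples of column k, which is already zero in
    \<open>?B\<close>.\<close>
  have "?B * M\<^sup>T = ?B"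
  proof (intro eq_matI)
    fix i j assume "i < dim_row ?B" "j < dim_col ?B"
    then have ij: "i < n" "j < n" by auto
    have "(?B * M\<^sup>T) $$ (i, j) = (\<Sum>l<n. ?B $$ (i, l) * M $$ (j, l))"
      using M ij by (simp add: scalar_prod_def atLeast0LessThan)
    also have "\<dots> = (\<Sum>l<n. (if j = l then ?B $$ (i, l) else 0)
        - (if l = k then ?B $$ (i, l) * (A $$ (j, k) / ?a) else 0))"
      using ij by (intro sum.cong) (auto simp: M_def algebra_simps)
    also have "\<dots> = ?B $$ (i, j) - ?B $$ (i, k) * (A $$ (j, k) / ?a)"
      using ij k by (simp add: sum_subtractf)
    also have "?B $$ (i, k) = 0"
      using ij k pos by simp
    finally show "(?B * M\<^sup>T) $$ (i, j) = ?B $$ (i, j)" by simp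
  qed (use M in auto)
  then show ?thesis
    using psd_cone_congruence[OF A M] MA by simp
qed

text \<open>Induction on a bound k such that all rows from k on vanish. Each step clears row k,
  either for free or by subtracting one rank one matrix, and preserves the zero rows below
  it.\<close>

lemma psd_cone_subset_rank_one_cone: "psd_cone n \<subseteq> mat_cone n (range (rank_one n))"
proof -
  have C: "range (rank_one n) \<subseteq> carrier_mat n n"
    by (auto simp: rank_one_def)
  have "A \<in> mat_cone n (range (rank_one n))"
    if "A \<in> psd_cone n" "k \<le> n" "\<And>i j. k \<le> i \<Longrightarrow> i < n \<Longrightarrow> j < n \<Longrightarrow> A $$ (i, j) = 0" for A k
    using that
  proof (induction k arbitrary: A)
    case 0
    then have "A = 0\<^sub>m n n"
      using psd_cone_carrier[of n] by (intro eq_matI) auto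
    then show ?case by (simp add: zero_in_mat_cone)
  next
    case (Suc k)
    note A = Suc.prems(1)
    have Ac: "A \<in> carrier_mat n n" using A psd_cone_carrier by auto
    have k: "k < n" using Suc.prems(2) by simp
    show ?case
    proof (cases "A $$ (k, k) = 0")
      \<comment> \<open>By semidefiniteness and symmetry, a zero pivot means that row k vanishes
        already, so nothing is subtracted.\<close>
      case True
      have "A $$ (i, j) = 0" if "k \<le> i" "i < n" "j < n" for i j
        using that Suc.prems(3)[of i j] psd_cone_diag_zero[OF A _ k True, of j] psd_cone_sym[OF A, of k j] k
        by (cases "i = k") auto
      then show ?thesis using Suc.IH[OF A] k by simp
    next
      case False
      let ?a = "A $$ (k, k)"
      have pos: "0 < ?a" using False psd_cone_diag_nonneg[OF A k] by simp
      let ?B = "mat n n (\<lambda>(i, j). A $$ (i, j) - A $$ (i, k) * A $$ (j, k) / ?a)"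
      \<comment> \<open>Column k scaled so that v_i v_j = A_ik A_jk / A_kk, exactly what the
        elimination removes.\<close>
      let ?v = "\<lambda>i. A $$ (i, k) / sqrt ?a"
      have zero: "?B $$ (i, j) = 0" if "k \<le> i" "i < n" "j < n" for i j
        using that Suc.prems(3)[of i] psd_cone_sym[OF A, of k j] k pos
        by (cases "i = k") auto
      have "?B \<in> mat_cone n (range (rank_one n))"
        by (rule Suc.IH[OF psd_cone_eliminate[OF A k pos] less_imp_le[OF k] zero])
      then have "?B + 1 \<cdot>\<^sub>m rank_one n ?v \<in> mat_cone n (range (rank_one n))"
        using C by (intro mat_cone_add_smult) auto
      also have "?B + 1 \<cdot>\<^sub>m rank_one n ?v = A"
        using Ac pos by (intro eq_matI) (auto simp: rank_one_def)
      finally show ?thesis .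
    qed
  qed
  \<comment> \<open>For k = n the condition on vanishing rows is vacuous.\<close>
  from this[of _ n] show ?thesis by auto
qed

section \<open>Compressions along columns of an orthogonal matrix\<close>

text \<open>The Householder reflection exchanging \<open>u\<close> and the unit vector \<open>e\<^sub>s\<close>; for \<open>u = e\<^sub>s\<close> the
  convention \<open>2 / 0 = 0\<close> turns it into the identity matrix.\<close>

lemma orthogonal_matrix_with_column:
  fixes u :: "nat \<Rightarrow> real"
  assumes u: "(\<Sum>i<n. (u i)\<^sup>2) = 1" and s: "s < n"
  obtains F where "F \<in> orthogonal_group n" "\<And>i. i < n \<Longrightarrow> F $$ (i, s) = u i"
proof -
  define w where "w i = u i - (if i = s then 1 else 0)" for i
  define d where "d = (\<Sum>i<n. (w i)\<^sup>2)"
  define c where "c = 2 / d"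
  define F where "F = mat n n (\<lambda>(i, j). (if i = j then 1 else 0) - c * w i * w j)"
  have "d = (\<Sum>i<n. (u i)\<^sup>2 + (if i = s then 1 - 2 * u i else 0))"
    unfolding d_def w_def by (intro sum.cong) (auto simp: power2_eq_square algebra_simps)
  also have "\<dots> = 2 * (1 - u s)"
    using u s by (simp add: sum.distrib)
  finally have d: "d = 2 * (1 - u s)" .
  \<comment> \<open>In F^T F = I - 2 c w w^T + c^2 d w w^T this cancels the last two terms. For d =
    0 both sides are 0.\<close>
  have cd: "c * c * d = 2 * c"
    by (simp add: c_def)
  have "F\<^sup>T * F = 1\<^sub>m n"
  proof (intro eq_matI)
    fix i j assume "i < dim_row (1\<^sub>m n :: real mat)" "j < dim_col (1\<^sub>m n :: real mat)"
    then have ij: "i < n" "j < n" by auto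
    have "(F\<^sup>T * F) $$ (i, j) = (\<Sum>l<n. F $$ (l, i) * F $$ (l, j))"
      using ij by (simp add: scalar_prod_def atLeast0LessThan F_def)
    also have "\<dots> = (\<Sum>l<n. (if l = i then if l = j then 1 else 0 else 0)
        - (if l = i then c * w l * w j else 0) - (if l = j then c * w l * w i else 0)
        + c * c * w i * w j * (w l)\<^sup>2)"
      using ij by (intro sum.cong) (auto simp: F_def algebra_simps power2_eq_square)
    also have "\<dots> = (if i = j then 1 else 0) - c * w i * w j - c * w j * w i + c * c * w i * w j * d"
      using ij by (simp add: sum.distrib sum_subtractf d_def sum_distrib_left)
    also have "\<dots> = (if i = j then 1 else 0) - 2 * c * (w i * w j) + (c * c * d) * (w i * w j)"
      by (simp add: algebra_simps)
    also have "\<dots> = 1\<^sub>m n $$ (i, j)"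
      using ij by (simp add: cd)
    finally show "(F\<^sup>T * F) $$ (i, j) = 1\<^sub>m n $$ (i, j)" .
  qed (auto simp: F_def)
  then have "F \<in> orthogonal_group n"
    by (simp add: orthogonal_group_def F_def)
  moreover have "F $$ (i, s) = u i" if i: "i < n" for i
  proof (cases "d = 0")
    case True
    then have "(w i)\<^sup>2 = 0"
      using i sum_nonneg_eq_0_iff[of "{..<n}" "\<lambda>i. (w i)\<^sup>2"] by (simp add: d_def)
    then show ?thesis using i s True by (simp add: F_def w_def c_def)
  next
    case False
    \<comment> \<open>Since w_s = u_s - 1 = -d / 2. Hence column s of \<open>F\<close> is e_s + w =
      u.\<close>
    then have "c * w s = - 1"
      using d by (simp add: c_def w_def field_simps)
    then have "c * w i * w s = - w i"
      by (metis mult.assoc mult.commute mult_minus1)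
    then show ?thesis using i s by (simp add: F_def w_def)
  qed
  ultimately show thesis by (rule that)
qed

section \<open>Column submatrices and the cones compressed along them\<close>

lemma column_submatrix_carrier:
  assumes "F \<in> carrier_mat n n" "S \<subseteq> {..<n}"
  shows "column_submatrix F S \<in> carrier_mat n (card S)"
proof -
  have "{j. j < n \<and> j \<in> S} = S" using assms(2) by auto
  then show ?thesis
    using carrier_matD[OF assms(1)]
    by (intro carrier_matI) (simp_all add: column_submatrix_def dim_submatrix)
qed

text \<open>Selected columns keep their order, so the new position of column s, counted from 0, is
  the number of smaller elements of S.\<close>

lemma column_submatrix_index:
  assumes F: "F \<in> carrier_mat n n" and S: "S \<subseteq> {..<n}" and i: "i < n" and s: "s \<in> S"
  shows "column_submatrix F S $$ (i, card {a \<in> S. a < s}) = F $$ (i, s)"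
proof -
  have "s < n" using S s by auto
  have "submatrix F UNIV S $$ (card {a \<in> UNIV. a < i}, card {a \<in> S. a < s}) = F $$ (i, s)"
    by (rule submatrix_index_card) (use F i \<open>s < n\<close> s in auto)
  then show ?thesis by (simp add: column_submatrix_def)
qed

text \<open>With G the column submatrix and p the position of column s in it, G (r e_p) = v. Hence G
  (r e_p)(r e_p)^T G^T = v v^T, and the middle factor is positive semidefinite of size
  \<open>card S\<close>.\<close>

lemma rank_one_smult_in_compressed_psd_cone:
  assumes F: "F \<in> carrier_mat n n" and S: "S \<subseteq> {..<n}" and s: "s \<in> S"
    and v: "\<And>i. i < n \<Longrightarrow> v i = r * F $$ (i, s)"
  shows "rank_one n v \<in> compressed_psd_cone n F S"
proof -
  let ?p = "card {a \<in> S. a < s}" and ?G = "column_submatrix F S"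
  have G: "?G \<in> carrier_mat n (card S)"
    using column_submatrix_carrier[OF F S] .
  have p: "?p < card S"
    \<comment> \<open>The elements of S below s form a proper subset, since s itself is
      missing.\<close>
    using s S by (intro psubset_card_mono) (auto intro: finite_subset)
  let ?e = "\<lambda>i. if i = ?p then r else 0"
  let ?E = "mat (card S) 1 (\<lambda>(i, j). ?e i)" and ?V = "mat n 1 (\<lambda>(i, j). v i)"
  have GE: "?G * ?E = ?V"
  proof (intro eq_matI)
    fix i j assume "i < dim_row ?V" "j < dim_col ?V"
    then have ij: "i < n" "j < 1" by auto
    have "(?G * ?E) $$ (i, j) = (\<Sum>l<card S. if l = ?p then ?G $$ (i, l) * r else 0)"
      using G ij
      by (simp add: scalar_prod_def atLeast0LessThan if_distrib[of "(*) _"] cong: if_cong)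
    also have "\<dots> = ?V $$ (i, j)"
      using p ij column_submatrix_index[OF F S ij(1) s] v by simp
    finally show "(?G * ?E) $$ (i, j) = ?V $$ (i, j)" .
  qed (use G in auto)
  have "?G * rank_one (card S) ?e * ?G\<^sup>T = ?G * ?E * (?E\<^sup>T * ?G\<^sup>T)"
    using G assoc_mult_mat[of ?G n "card S" ?E 1 "?E\<^sup>T" "card S"]
      assoc_mult_mat[of "?G * ?E" n 1 "?E\<^sup>T" "card S" "?G\<^sup>T" n]
    by (simp add: rank_one_eq_mult_transpose del: assoc_mult_mat)
  also have "?E\<^sup>T * ?G\<^sup>T = ?V\<^sup>T"
    using transpose_mult[OF G, of ?E 1] GE by simp
  finally have "?G * rank_one (card S) ?e * ?G\<^sup>T = rank_one n v"
    by (simp only: GE rank_one_eq_mult_transpose[of n v])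
  then show ?thesis
    unfolding compressed_psd_cone_def using rank_one_psd
    by (intro CollectI conjI bexI[of _ "rank_one (card S) ?e"]) simp_all
qed

text \<open>Non-emptiness of S supplies the column s. The orthogonal matrix depends on v, because
  its column s must point along v.\<close>

lemma rank_one_in_compressed_psd_cone:
  assumes S: "S \<subseteq> {..<n}" "S \<noteq> {}"
  shows "\<exists>F\<in>orthogonal_group n. rank_one n v \<in> compressed_psd_cone n F S"
proof -
  obtain s where s: "s \<in> S" "s < n" using S by auto
  define r where "r = sqrt (\<Sum>i<n. (v i)\<^sup>2)"
  have r2: "r\<^sup>2 = (\<Sum>i<n. (v i)\<^sup>2)"
    by (simp add: r_def sum_nonneg)
  \<comment> \<open>For v = 0 the quotient would give the zero vector. A unit vector is required,
    and e_s serves, as it is then scaled by r = 0.\<close>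
  define u where "u i = (if r = 0 then if i = s then 1 else 0 else v i / r)" for i
  have "(\<Sum>i<n. (u i)\<^sup>2) = 1"
  proof (cases "r = 0")
    case True
    then have "(\<Sum>i<n. (u i)\<^sup>2) = (\<Sum>i<n. if i = s then 1 else 0)"
      by (intro sum.cong) (auto simp: u_def)
    then show ?thesis using s by simp
  next
    case False
    then have "(\<Sum>i<n. (u i)\<^sup>2) = (\<Sum>i<n. (v i)\<^sup>2) / r\<^sup>2"
      by (simp add: u_def power_divide sum_divide_distrib)
    then show ?thesis using False r2[symmetric] by simp
  qed
  then obtain F where F: "F \<in> orthogonal_group n" "\<And>i. i < n \<Longrightarrow> F $$ (i, s) = u i"
    using orthogonal_matrix_with_column s(2) by blast
  have "v i = r * F $$ (i, s)" if i: "i < n" for i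
  proof (cases "r = 0")
    case True
    then have "(\<Sum>i<n. (v i)\<^sup>2) = 0" using r2 by simp
    then have "v i = 0" using i by (simp add: sum_nonneg_eq_0_iff)
    then show ?thesis using True by simp
  next
    case False
    then show ?thesis using F(2)[OF i] by (simp add: u_def)
  qed
  then have "rank_one n v \<in> compressed_psd_cone n F S"
    using F(1) S s by (intro rank_one_smult_in_compressed_psd_cone) (auto simp: orthogonal_group_def)
  then show ?thesis using F(1) by blast
qed

text \<open>The map sending Y to G Y G^T is linear, so it carries conic combinations in the small
  cone to conic combinations of the images.\<close>

lemma is_subcone_compressed_psd_cone:
  assumes F: "F \<in> carrier_mat n n" and S: "S \<subseteq> {..<n}"
  shows "is_subcone n (compressed_psd_cone n F S) (psd_cone n)"
proof -
  let ?G = "column_submatrix F S" and ?K = "compressed_psd_cone n F S"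
  have G: "?G \<in> carrier_mat n (card S)"
    using column_submatrix_carrier[OF F S] .
  have sub: "?K \<subseteq> psd_cone n" by (auto simp: compressed_psd_cone_def)
  then have C: "?K \<subseteq> carrier_mat n n" using psd_cone_carrier by blast
  have "mat_cone n ?K \<subseteq> ?K"
  proof (rule mat_cone_subsetI[OF C])
    have "0\<^sub>m n n = ?G * 0\<^sub>m (card S) (card S) * ?G\<^sup>T" using G by simp
    then show "0\<^sub>m n n \<in> ?K"
      unfolding compressed_psd_cone_def using zero_in_psd_cone by blast
  next
    fix A X and c :: real
    assume A: "A \<in> ?K" and X: "X \<in> ?K" and c: "0 \<le> c"
    obtain Y Z where Y: "Y \<in> psd_cone (card S)" "A = ?G * Y * ?G\<^sup>T"
      and Z: "Z \<in> psd_cone (card S)" "X = ?G * Z * ?G\<^sup>T"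
      using A X by (auto simp: compressed_psd_cone_def)
    have YZ: "Y \<in> carrier_mat (card S) (card S)" "Z \<in> carrier_mat (card S) (card S)"
      using Y Z psd_cone_carrier by auto
    have "?G * (Y + c \<cdot>\<^sub>m Z) = ?G * Y + c \<cdot>\<^sub>m (?G * Z)"
      using G YZ
      by (simp add: mult_add_distrib_mat[of _ n "card S" _ "card S"]
          mult_smult_distrib[of _ n "card S" _ "card S"])
    moreover have "(?G * Y + c \<cdot>\<^sub>m (?G * Z)) * ?G\<^sup>T = A + c \<cdot>\<^sub>m X"
      using G YZ unfolding Y Z
      by (subst add_mult_distrib_mat[of _ n "card S"])
        (simp_all add: mult_smult_assoc_mat[of _ n "card S" _ n] del: assoc_mult_mat)
    ultimately have "?G * (Y + c \<cdot>\<^sub>m Z) * ?G\<^sup>T = A + c \<cdot>\<^sub>m X" by simp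
    moreover have "A + c \<cdot>\<^sub>m X \<in> psd_cone n"
      using A X c sub by (intro psd_cone_add_smult) auto
    ultimately show "A + c \<cdot>\<^sub>m X \<in> ?K"
      unfolding compressed_psd_cone_def using psd_cone_add_smult[OF Y(1) Z(1) c]
      by (intro CollectI conjI bexI[of _ "Y + c \<cdot>\<^sub>m Z"]) simp_all
  qed
  then show ?thesis
    using sub subset_mat_cone[OF C] by (auto simp: is_subcone_def)
qed

theorem theorem2:
  fixes n :: nat and \<S> :: "nat set set"
  assumes "n \<ge> 1"
    and "\<S> \<noteq> {}"
    and "\<And>S. S \<in> \<S> \<Longrightarrow> S \<noteq> {} \<and> S \<subseteq> {..<n}"
  shows "psd_cone n =
           mat_cone n (\<Union>S\<in>\<S>. \<Union>F\<in>orthogonal_group n. compressed_psd_cone n F S)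
         \<and> (\<forall>S\<in>\<S>. \<forall>F\<in>orthogonal_group n.
              is_subcone n (compressed_psd_cone n F S) (psd_cone n))"
proof -
  let ?C = "\<Union>S\<in>\<S>. \<Union>F\<in>orthogonal_group n. compressed_psd_cone n F S"
  have sub: "?C \<subseteq> psd_cone n" by (auto simp: compressed_psd_cone_def)
  then have C: "?C \<subseteq> carrier_mat n n" using psd_cone_carrier by blast
  obtain S where S: "S \<in> \<S>" using assms(2) by auto
  \<comment> \<open>A single member of the collection already yields every rank one matrix v v^T, as
    F runs through the orthogonal group.\<close>
  have "range (rank_one n) \<subseteq> ?C"
    using rank_one_in_compressed_psd_cone[of S n] assms(3)[OF S] S by fastforce
  then have "mat_cone n (range (rank_one n)) \<subseteq> mat_cone n ?C"
    unfolding mat_cone_def by blast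
  moreover have "mat_cone n ?C \<subseteq> psd_cone n"
    using sub by (intro mat_cone_subsetI[OF C] zero_in_psd_cone psd_cone_add_smult) auto
  \<comment> \<open>The chain of inclusions closes: psd cone, cone of the rank one matrices, cone of
    \<open>?C\<close>, psd cone.\<close>
  ultimately have "psd_cone n = mat_cone n ?C"
    using psd_cone_subset_rank_one_cone by blast
  moreover have "is_subcone n (compressed_psd_cone n F S) (psd_cone n)"
    if "S \<in> \<S>" "F \<in> orthogonal_group n" for S F
    using that assms(3) by (intro is_subcone_compressed_psd_cone) (auto simp: orthogonal_group_def)
  ultimately show ?thesis by blast
qed

end
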